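(* Let $G$ be a $(q+1)$-regular diagram with $L_2^0(G)\ne 0$, and let $G'$ be a finite connected subgraph of $G$ with $n\ge 2$ vertices such that every edge of $G$ joining two vertices of $G'$ is an edge of $G'$, with weights inherited from $G$. Let $\lambda_1\le\cdots\le\lambda_n$ be the (real) eigenvalues of the adjacency operator $\delta'$ of $G'$. Then $$-(q+1)\le\lambda_1,\quad m\le\lambda_2,\quad \lambda_{n-1}\le M,\quad \lambda_n\le q+1.$$
   Context: A graph (Serre's sense) has vertices $V(G)$, oriented edges $E(G)$, maps $e\mapsto(o(e),t(e))$, $e\mapsto\bar e$ with $\bar{\bar e}=e\ne\bar e$, $t(\bar e)=o(e)$; it is connected, has no loops, each vertex is the terminus of finitely many edges; multiple edges allowed. Weights $w:E(G)\to\mathbb{Z}_{>0}$ with $w(\bar e)=w(e)$, $w:V(G)\to\mathbb{Z}_{>0}$. $G$ is a $(q+1)$-regular diagram if: (i) $V(G)=O\sqcup I$ with every edge joining $O$ and $I$; (ii) $w(e)\mid w(t(e))$; (iii) $\sum_{t(e)=v}w(v)/w(e)=q+1$ for all $v$; (iv) $\sum_v w(v)^{-1}<\infty$. $L_2(G)$: functions $V(G)\to\mathbb{C}$ with $\langle f,g\rangle=\sum_v f(v)\overline{g(v)}w(v)^{-1}$; adjacency operator $(\delta f)(v)=\sum_{t(e)=v}\frac{w(v)}{w(e)}f(o(e))$. $L_2^0(G)=\{f\in L_2(G):\sum_{v\in I}f(v)w(v)^{-1}=\sum_{v\in O}f(v)w(v)^{-1}=0\}$. $m=\inf\{\langle\delta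 f,f\rangle: f\in L_2^0(G),\|f\|=1\}$, $M=\sup\{\langle\delta f,f\rangle:f\in L_2^0(G),\|f\|=1\}$. The adjacency operator of $G'$ is $(\delta' f)(v)=\sum_{e\in E(G'),t(e)=v}\frac{w(v)}{w(e)}f(o(e))$ on functions on $V(G')$, which is Hermitian for the inner product $\sum_{v\in V(G')}f(v)\overline{g(v)}w(v)^{-1}$. *)

theory Defs
  imports
    "HOL-Analysis.Infinite_Sum"
    "Graph_Theory.Graph_Theory"
    "Jordan_Normal_Form.Char_Poly"
begin

text \<open>
  Graphs in the sense of Serre: the oriented edges are the arcs, \<open>tail\<close> is the origin,
  \<open>head\<close> the terminus, and \<open>arev\<close> the fixed-point-free edge reversal
  (\<open>bidirected_digraph\<close> also asks that \<open>arev\<close> be the identity outside the set of arcs).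
\<close>

locale serre_graph = bidirected_digraph G arev + loopfree_digraph G
  for G :: "('v, 'e) pre_digraph" and arev :: "'e \<Rightarrow> 'e" +
  assumes connected_graph: "Digraph_Component.connected G"
    and finite_in_arcs: "v \<in> verts G \<Longrightarrow> finite (in_arcs G v)"

locale regular_diagram = serre_graph G arev
  for G :: "('v, 'e) pre_digraph" and arev :: "'e \<Rightarrow> 'e" +
  fixes VO VI :: "'v set" and vw :: "'v \<Rightarrow> nat" and ew :: "'e \<Rightarrow> nat" and q :: nat
  assumes vw_pos: "v \<in> verts G \<Longrightarrow> 0 < vw v"
    and ew_pos: "e \<in> arcs G \<Longrightarrow> 0 < ew e"
    and ew_arev: "e \<in> arcs G \<Longrightarrow> ew (arev e) = ew e"
    and verts_partition: "verts G = VO \<union> VI" "VO \<inter> VI = {}"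
    and arcs_bipartite: "e \<in> arcs G \<Longrightarrow>
      tail G e \<in> VO \<and> head G e \<in> VI \<or> tail G e \<in> VI \<and> head G e \<in> VO"
    and ew_dvd: "e \<in> arcs G \<Longrightarrow> ew e dvd vw (head G e)"
    and regular: "v \<in> verts G \<Longrightarrow> (\<Sum>e\<in>in_arcs G v. real (vw v) / real (ew e)) = real q + 1"
    and finite_volume: "(\<lambda>v. 1 / real (vw v)) summable_on verts G"

text \<open>
  Functions on the vertex set are represented by functions on the whole type that vanish
  outside the vertex set.
\<close>

definition L2 :: "('v, 'e) pre_digraph \<Rightarrow> ('v \<Rightarrow> nat) \<Rightarrow> ('v \<Rightarrow> complex) set" where
  "L2 G vw = {f. (\<forall>v. v \<notin> verts G \<longrightarrow> f v = 0) \<and>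
                 (\<lambda>v. (cmod (f v))\<^sup>2 / real (vw v)) summable_on verts G}"

definition l2_inner ::
    "('v, 'e) pre_digraph \<Rightarrow> ('v \<Rightarrow> nat) \<Rightarrow> ('v \<Rightarrow> complex) \<Rightarrow> ('v \<Rightarrow> complex) \<Rightarrow> complex" where
  "l2_inner G vw f g = (\<Sum>\<^sub>\<infinity>v\<in>verts G. f v * cnj (g v) / of_nat (vw v))"

definition l2_norm :: "('v, 'e) pre_digraph \<Rightarrow> ('v \<Rightarrow> nat) \<Rightarrow> ('v \<Rightarrow> complex) \<Rightarrow> real" where
  "l2_norm G vw f = sqrt (Re (l2_inner G vw f f))"

text \<open>
  The sums over \<open>VO\<close> and \<open>VI\<close> converge absolutely for \<open>f \<in> L2 G vw\<close>, by the Cauchy--Schwarz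
  inequality and \<open>finite_volume\<close>, so the value 0 is never a default value of \<open>infsum\<close>.
\<close>

definition L20 ::
    "('v, 'e) pre_digraph \<Rightarrow> 'v set \<Rightarrow> 'v set \<Rightarrow> ('v \<Rightarrow> nat) \<Rightarrow> ('v \<Rightarrow> complex) set" where
  "L20 G VO VI vw = {f \<in> L2 G vw.
     (\<Sum>\<^sub>\<infinity>v\<in>VI. f v / of_nat (vw v)) = 0 \<and> (\<Sum>\<^sub>\<infinity>v\<in>VO. f v / of_nat (vw v)) = 0}"

definition adj_op ::
    "('v, 'e) pre_digraph \<Rightarrow> ('v \<Rightarrow> nat) \<Rightarrow> ('e \<Rightarrow> nat) \<Rightarrow> ('v \<Rightarrow> complex) \<Rightarrow> 'v \<Rightarrow> complex" where
  "adj_op G vw ew f v = (\<Sum>e\<in>in_arcs G v. of_nat (vw v) / of_nat (ew e) * f (tail G e))"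

text \<open>
  As \<open>adj_op\<close> is Hermitian, the inner products below are real; \<open>Re\<close> only adjusts the type.
\<close>

definition quad_values ::
    "('v, 'e) pre_digraph \<Rightarrow> 'v set \<Rightarrow> 'v set \<Rightarrow> ('v \<Rightarrow> nat) \<Rightarrow> ('e \<Rightarrow> nat) \<Rightarrow> real set" where
  "quad_values G VO VI vw ew =
     {Re (l2_inner G vw (adj_op G vw ew f) f) | f. f \<in> L20 G VO VI vw \<and> l2_norm G vw f = 1}"

definition m_const ::
    "('v, 'e) pre_digraph \<Rightarrow> 'v set \<Rightarrow> 'v set \<Rightarrow> ('v \<Rightarrow> nat) \<Rightarrow> ('e \<Rightarrow> nat) \<Rightarrow> real" where
  "m_const G VO VI vw ew = Inf (quad_values G VO VI vw ew)"

definition M_const ::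
    "('v, 'e) pre_digraph \<Rightarrow> 'v set \<Rightarrow> 'v set \<Rightarrow> ('v \<Rightarrow> nat) \<Rightarrow> ('e \<Rightarrow> nat) \<Rightarrow> real" where
  "M_const G VO VI vw ew = Sup (quad_values G VO VI vw ew)"

text \<open>
  For a finite set enumerated by \<open>vs\<close>, \<open>op_matrix vs T\<close> is the matrix of the operator \<open>T\<close> in
  the basis of indicator functions.  \<open>eigenvalue_list S T ls\<close> says that \<open>ls\<close> lists the
  eigenvalues of \<open>T\<close> on the functions on \<open>S\<close> in increasing order and with multiplicity, all
  of them being real; the enumeration does not matter, since reordering it conjugates the
  matrix by a permutation.
\<close>

definition op_matrix :: "'v list \<Rightarrow> (('v \<Rightarrow> complex) \<Rightarrow> 'v \<Rightarrow> complex) \<Rightarrow> complex mat" where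
  "op_matrix vs T = mat (length vs) (length vs)
     (\<lambda>(i, j). T (\<lambda>v. if v = vs ! j then 1 else 0) (vs ! i))"

definition eigenvalue_list ::
    "'v set \<Rightarrow> (('v \<Rightarrow> complex) \<Rightarrow> 'v \<Rightarrow> complex) \<Rightarrow> real list \<Rightarrow> bool" where
  "eigenvalue_list S T ls \<longleftrightarrow> sorted ls \<and>
     (\<exists>vs. distinct vs \<and> set vs = S \<and>
        char_poly (op_matrix vs T) = (\<Prod>x\<leftarrow>ls. [:- complex_of_real x, 1:]))"

text \<open>The eigenvalues of the adjacency operator of a finite induced subgraph are indeed real.\<close>

lemma (in regular_diagram) ex_eigenvalue_list:
  assumes ind: "induced_subgraph H G" and fin: "fin_digraph H"
  shows "\<exists>ls. eigenvalue_list (verts H) (adj_op H vw ew) ls"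
proof -
  interpret H: fin_digraph H by (rule fin)
  have compat: "subgraph H G" "compatible G H"
    and arcsH: "arcs H = {e \<in> arcs G. tail G e \<in> verts H \<and> head G e \<in> verts H}"
    using ind unfolding induced_subgraph_def subgraph_def by iprover+
  have sub: "verts H \<subseteq> verts G" "tail H = tail G" "head H = head G"
    using compat unfolding subgraph_def compatible_def by (iprover intro: sym)+
  obtain vs where vs: "set vs = verts H" "distinct vs"
    using finite_distinct_list[OF H.finite_verts] by blast
  define n where "n = length vs"
  define A where "A = op_matrix vs (adj_op H vw ew)"
  have A: "A \<in> carrier_mat n n" by (simp add: A_def op_matrix_def n_def)
  define c where "c u v = (\<Sum>e\<in>{e \<in> arcs H. head G e = u \<and> tail G e = v}. 1 / real (ew e))" for u v
  have c_sym: "c u v = c v u" for u v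
    unfolding c_def
    by (rule sum.reindex_bij_witness[of _ arev arev]) (auto simp: arcsH ew_arev)
  have vpos: "0 < real (vw (vs ! i))" if "i < n" for i
    using that vs(1) sub(1) vw_pos[of "vs ! i"] nth_mem[of i vs] unfolding n_def by auto
  have Aij: "A $$ (i, j) = of_real (vw (vs ! i) * c (vs ! i) (vs ! j))" if "i < n" "j < n" for i j
  proof -
    have "A $$ (i, j) = (\<Sum>e\<in>in_arcs H (vs ! i).
        of_nat (vw (vs ! i)) / of_nat (ew e) * (if tail G e = vs ! j then 1 else 0))"
      using that by (simp add: A_def op_matrix_def n_def adj_op_def sub)
    also have "\<dots> = (\<Sum>e\<in>{e \<in> arcs H. head G e = vs ! i \<and> tail G e = vs ! j}.
        of_nat (vw (vs ! i)) / of_nat (ew e))"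
      by (rule sum.mono_neutral_cong_right) (auto simp: sub in_arcs_def)
    finally show ?thesis by (simp add: c_def sum_distrib_left)
  qed
  obtain as where as: "char_poly A = (\<Prod>a\<leftarrow>as. [:- a, 1:])"
    using char_poly_factorized[OF A] by blast
  have real: "k \<in> \<real>" if "k \<in> set as" for k
  proof -
    have "poly (char_poly A) k = 0"
      unfolding as poly_prod_list using that by (auto simp: prod_list_zero_iff)
    then obtain x where x: "x \<in> carrier_vec n" "x \<noteq> 0\<^sub>v n" "A *\<^sub>v x = k \<cdot>\<^sub>v x"
      using A by (auto simp: eigenvalue_root_char_poly[OF A, symmetric]
          eigenvalue_def eigenvector_def)
    have row: "(\<Sum>j<n. A $$ (i, j) * x $ j) = k * x $ i" if "i < n" for i
    proof -
      have "(A *\<^sub>v x) $ i = (\<Sum>j<n. A $$ (i, j) * x $ j)"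
        using that A x(1) by (simp add: scalar_prod_def atLeast0LessThan)
      then show ?thesis using x that by simp
    qed
    define Q where "Q = (\<Sum>i<n. \<Sum>j<n. of_real (c (vs ! i) (vs ! j)) * (cnj (x $ i) * x $ j))"
    define N where "N = (\<Sum>i<n. (cmod (x $ i))\<^sup>2 / vw (vs ! i))"
    have "Q = (\<Sum>i<n. cnj (x $ i) / of_nat (vw (vs ! i)) * (\<Sum>j<n. A $$ (i, j) * x $ j))"
      unfolding Q_def sum_distrib_left
    proof (intro sum.cong refl)
      fix i j assume "i \<in> {..<n}" "j \<in> {..<n}"
      then show "of_real (c (vs ! i) (vs ! j)) * (cnj (x $ i) * x $ j) =
          cnj (x $ i) / of_nat (vw (vs ! i)) * (A $$ (i, j) * x $ j)"
        using vpos[of i] by (simp add: Aij)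
    qed
    also have "\<dots> = (\<Sum>i<n. k * of_real ((cmod (x $ i))\<^sup>2 / vw (vs ! i)))"
    proof (intro sum.cong refl)
      fix i assume "i \<in> {..<n}"
      then have "(\<Sum>j<n. A $$ (i, j) * x $ j) = k * x $ i" by (simp add: row)
      moreover have "complex_of_real ((cmod (x $ i))\<^sup>2) = x $ i * cnj (x $ i)"
        by (rule complex_norm_square)
      ultimately show "cnj (x $ i) / of_nat (vw (vs ! i)) * (\<Sum>j<n. A $$ (i, j) * x $ j) =
          k * of_real ((cmod (x $ i))\<^sup>2 / vw (vs ! i))"
        by (simp only: of_real_divide of_real_of_nat_eq times_divide_eq_left times_divide_eq_right mult_ac)
    qed
    also have "\<dots> = k * of_real N" by (simp add: N_def sum_distrib_left)
    finally have Q: "Q = k * of_real N" .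
    have "cnj Q = (\<Sum>i<n. \<Sum>j<n. of_real (c (vs ! j) (vs ! i)) * (cnj (x $ j) * x $ i))"
      unfolding Q_def by (simp, intro sum.cong refl, subst c_sym, simp)
    also have "\<dots> = Q" unfolding Q_def by (rule sum.swap)
    finally have "Q \<in> \<real>" by (simp add: Reals_cnj_iff)
    obtain i where i: "i < n" "x $ i \<noteq> 0"
      using x(1,2) by (metis carrier_vecD eq_vecI index_zero_vec)
    have "0 < N"
      unfolding N_def using i vpos by (intro sum_pos2[of _ i]) auto
    then have "k = Q / of_real N" by (simp add: Q)
    then show ?thesis using \<open>Q \<in> \<real>\<close> by simp
  qed
  define ls where "ls = sort (map Re as)"
  have "map (complex_of_real \<circ> Re) as = as"
    by (rule map_idI) (simp add: real)
  then have mset_as: "mset as = mset (map complex_of_real ls)"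
    by (metis ls_def map_map mset_map mset_sort)
  have prod: "(\<Prod>a\<leftarrow>bs. [:- a, 1:]) = prod_mset (image_mset (\<lambda>a. [:- a, 1:]) (mset bs))"
    for bs :: "complex list"
    by (simp only: mset_map[symmetric] prod_mset_prod_list)
  have "char_poly A = (\<Prod>a\<leftarrow>map complex_of_real ls. [:- a, 1:])"
    unfolding as prod mset_as by (rule refl)
  then have "char_poly A = (\<Prod>x\<leftarrow>ls. [:- complex_of_real x, 1:])"
    unfolding map_map comp_def .
  moreover have "sorted ls" unfolding ls_def by (rule sorted_sort)
  ultimately show ?thesis
    unfolding eigenvalue_list_def A_def using vs by blast
qed

end

theory Submission
  imports Defs "Jordan_Normal_Form.Schur_Decomposition"
begin

text \<open>
  The adjacency form \<open>\<langle>\<delta> f, f\<rangle>\<close> is bounded by \<open>q + 1\<close>, and for \<open>s = \<plusminus> 1\<close> the function equal to \<open>1\<close>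
  on \<open>VI\<close> and to \<open>s\<close> on \<open>VO\<close> is an eigenfunction with eigenvalue \<open>s (q + 1)\<close>.  These two functions
  span the orthogonal complement of \<open>L20\<close>.  The span of eigenfunctions for the two lowest
  eigenvalues of the subgraph contains a nonzero \<open>h\<close> orthogonal to the eigenfunction for
  \<open>- (q + 1)\<close>; as \<open>q + 1\<close> is the largest possible value of the Rayleigh quotient, the remaining
  component of \<open>h\<close> outside \<open>L20\<close> can only raise it above \<open>m\<close>, while it is at most \<open>\<lambda>\<^sub>2\<close>.
  Replacing \<open>\<delta>\<close> by \<open>- \<delta>\<close> gives the bound for \<open>M\<close>.
\<close>

section \<open>The first two columns of a Schur basis\<close>

text \<open>The matrix of the adjacency operator need not be Hermitian for the standard inner
  product, since vertex weights vary. Schur triangularization avoids this, prescribes the order of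
  the diagonal and covers \<open>a = b\<close>. From \<open>A * P = P * B\<close> with
  \<open>B\<close> upper triangular, the first two columns of \<open>P\<close> span an invariant
  plane.\<close>

lemma schur_first_two_columns:
  fixes A :: "complex mat"
  assumes A: "A \<in> carrier_mat n n"
    and cp: "char_poly A = (\<Prod>x\<leftarrow>a # b # es. [:- x, 1:])"
  obtains x y c where "x \<in> carrier_vec n" "y \<in> carrier_vec n"
    "A *\<^sub>v x = a \<cdot>\<^sub>v x" "A *\<^sub>v y = c \<cdot>\<^sub>v x + b \<cdot>\<^sub>v y"
    "x \<noteq> 0\<^sub>v n" "\<And>k. y \<noteq> k \<cdot>\<^sub>v x"
proof -
  obtain B P Q where schur: "schur_decomposition A (a # b # es) = (B, P, Q)"
    by (metis prod_cases3)
  from schur_decomposition[OF A cp schur]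
  have sim: "similar_mat_wit A B P Q" and ut: "upper_triangular B" and dg: "diag_mat B = a # b # es"
    by auto
  note w = similar_mat_witD2[OF A sim]
  have B: "B \<in> carrier_mat n n" and P: "P \<in> carrier_mat n n" and Q: "Q \<in> carrier_mat n n"
    and QP: "Q * P = 1\<^sub>m n" and APBQ: "A = P * B * Q" using w by auto
  have "length (diag_mat B) = n" using B by (simp add: diag_mat_def)
  then have n: "n \<ge> 2" using dg by simp
  have "diag_mat B ! 0 = B $$ (0, 0)" "diag_mat B ! 1 = B $$ (1, 1)"
    using B n by (auto simp: diag_mat_def)
  then have B00: "B $$ (0, 0) = a" and B11: "B $$ (1, 1) = b" using dg by auto
  have Bz: "B $$ (i, j) = 0" if "j < i" "i < n" for i j
    using ut B that unfolding upper_triangular_def by auto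
  have AP: "A * P = P * B"
  proof -
    have "A * P = P * B * (Q * P)"
      unfolding APBQ using B P Q by (intro assoc_mult_mat) auto
    then show ?thesis using B P QP by simp
  qed
  have Acol: "A *\<^sub>v col P j = P *\<^sub>v col B j" if "j < n" for j
  proof -
    have "A *\<^sub>v col P j = col (A * P) j"
      using A P that by (intro col_mult2[symmetric]) auto
    also have "\<dots> = P *\<^sub>v col B j"
      unfolding AP using B P that by (intro col_mult2) auto
    finally show ?thesis .
  qed
  have PB: "(P *\<^sub>v col B j) $ i = (\<Sum>k<n. P $$ (i, k) * B $$ (k, j))" if "i < n" "j < n" for i j
    using that P B by (simp add: scalar_prod_def atLeast0LessThan)
  \<comment> \<open>Since \<open>Q\<close> sends the columns of \<open>P\<close> to unit vectors,
    nonvanishing and independence of the first two columns can be read off coordinates.\<close>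
  have Qcol: "Q *\<^sub>v col P j = unit_vec n j" if "j < n" for j
    using that Q P QP col_mult2[OF Q P, of j] by simp
  have c0: "A *\<^sub>v col P 0 = a \<cdot>\<^sub>v col P 0"
  proof (rule eq_vecI)
    fix i assume "i < dim_vec (a \<cdot>\<^sub>v col P 0)"
    then have i: "i < n" using P by simp
    have "(\<Sum>k<n. P $$ (i, k) * B $$ (k, 0)) = (\<Sum>k\<in>{0}. P $$ (i, k) * B $$ (k, 0))"
      using n by (intro sum.mono_neutral_right) (auto simp: Bz)
    then show "(A *\<^sub>v col P 0) $ i = (a \<cdot>\<^sub>v col P 0) $ i"
      using i n P PB[OF i, of 0] by (simp add: Acol B00 del: index_mult_mat_vec)
  qed (use A P in auto)
  have c1: "A *\<^sub>v col P 1 = B $$ (0, 1) \<cdot>\<^sub>v col P 0 + b \<cdot>\<^sub>v col P 1"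
  proof (rule eq_vecI)
    fix i assume "i < dim_vec (B $$ (0, 1) \<cdot>\<^sub>v col P 0 + b \<cdot>\<^sub>v col P 1)"
    then have i: "i < n" using P by simp
    have "(\<Sum>k<n. P $$ (i, k) * B $$ (k, 1)) = (\<Sum>k\<in>{0, 1}. P $$ (i, k) * B $$ (k, 1))"
      using n by (intro sum.mono_neutral_right) (auto simp: Bz)
    then show "(A *\<^sub>v col P 1) $ i = (B $$ (0, 1) \<cdot>\<^sub>v col P 0 + b \<cdot>\<^sub>v col P 1) $ i"
      using i n P PB[OF i, of 1] by (simp add: Acol B11[simplified] del: index_mult_mat_vec)
  qed (use A P in auto)
  have x0: "col P 0 \<noteq> 0\<^sub>v n"
  proof
    assume "col P 0 = 0\<^sub>v n"
    moreover have "Q *\<^sub>v 0\<^sub>v n = 0\<^sub>v n" using Q by (intro eq_vecI) auto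
    ultimately have "unit_vec n 0 = (0\<^sub>v n :: complex vec)" using Qcol[of 0] n by simp
    then have "(unit_vec n 0 :: complex vec) $ 0 = 0" using n by simp
    then show False using n by simp
  qed
  have y0: "col P 1 \<noteq> k \<cdot>\<^sub>v col P 0" for k
  proof
    assume eq: "col P 1 = k \<cdot>\<^sub>v col P 0"
    have "unit_vec n 1 = Q *\<^sub>v (k \<cdot>\<^sub>v col P 0)" using Qcol[of 1] n eq by simp
    also have "\<dots> = k \<cdot>\<^sub>v (Q *\<^sub>v col P 0)" using Q P by (intro mult_mat_vec) auto
    also have "\<dots> = k \<cdot>\<^sub>v unit_vec n 0" using Qcol[of 0] n by simp
    finally have "(unit_vec n 1 :: complex vec) $ 1 = (k \<cdot>\<^sub>v unit_vec n 0) $ 1" by simp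
    then show False using n by simp
  qed
  show ?thesis
    using that[OF _ _ c0 c1 x0 y0] P by (metis carrier_matD(1) col_dim)
qed

text \<open>Extension by zero lets the two functions be tested later against the operator of the
  whole graph. The off-diagonal coefficient \<open>c\<close> is kept here and disappears once the
  pair is orthogonalized.\<close>

lemma eigenfunction_pair:
  assumes ar: "finite (arcs H)" "\<And>e. e \<in> arcs H \<Longrightarrow> tail H e \<in> verts H"
    and vs: "distinct vs" "set vs = verts H"
    and cp: "char_poly (op_matrix vs (adj_op H vw ew)) = (\<Prod>x\<leftarrow>a # b # es. [:- x, 1:])"
  obtains f g c where "\<forall>v. v \<notin> verts H \<longrightarrow> f v = 0" "\<forall>v. v \<notin> verts H \<longrightarrow> g v = 0"
    "\<forall>v\<in>verts H. adj_op H vw ew f v = a * f v"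
    "\<forall>v\<in>verts H. adj_op H vw ew g v = c * f v + b * g v"
    "f \<noteq> (\<lambda>_. 0)" "\<forall>k. g \<noteq> (\<lambda>v. k * f v)"
proof -
  define n where "n = length vs"
  define A where "A = op_matrix vs (adj_op H vw ew)"
  have A: "A \<in> carrier_mat n n" by (simp add: A_def op_matrix_def n_def)
  obtain x y c where xy: "x \<in> carrier_vec n" "y \<in> carrier_vec n"
    "A *\<^sub>v x = a \<cdot>\<^sub>v x" "A *\<^sub>v y = c \<cdot>\<^sub>v x + b \<cdot>\<^sub>v y"
    "x \<noteq> 0\<^sub>v n" "\<And>k. y \<noteq> k \<cdot>\<^sub>v x"
    using schur_first_two_columns[OF A cp[folded A_def]] by metis
  \<comment> \<open>\<open>F z\<close> has coordinates \<open>z\<close> in the basis of indicator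
    functions, so \<open>TF\<close> below turns the matrix back into the operator.\<close>
  define F where "F z v = (\<Sum>j<n. z $ j * (if v = vs ! j then 1 else 0))" for z :: "complex vec" and v
  have F0: "F z v = 0" if "v \<notin> verts H" for z v
    using that vs nth_mem unfolding F_def n_def by (intro sum.neutral) (auto simp: n_def)
  have Fi: "F z (vs ! i) = z $ i" if "i < n" for z i
  proof -
    have "F z (vs ! i) = (\<Sum>j<n. if j = i then z $ j else 0)"
      unfolding F_def using that vs(1)
      by (intro sum.cong) (auto simp: n_def nth_eq_iff_index_eq)
    then show ?thesis using that by simp
  qed
  have TF: "adj_op H vw ew (F z) (vs ! i) = (A *\<^sub>v z) $ i" if "i < n" "z \<in> carrier_vec n" for z i
  proof -
    have "(A *\<^sub>v z) $ i = (\<Sum>j<n. A $$ (i, j) * z $ j)"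
      using that A by (simp add: scalar_prod_def atLeast0LessThan)
    also have "\<dots> = (\<Sum>j<n. \<Sum>e\<in>in_arcs H (vs ! i). of_nat (vw (vs ! i)) / of_nat (ew e) *
        (z $ j * (if tail H e = vs ! j then 1 else 0)))"
      using that by (intro sum.cong) (auto simp: A_def op_matrix_def n_def adj_op_def
          sum_distrib_left sum_distrib_right intro!: sum.cong)
    also have "\<dots> = adj_op H vw ew (F z) (vs ! i)"
      unfolding adj_op_def F_def by (subst sum.swap) (simp add: sum_distrib_left)
    finally show ?thesis ..
  qed
  have idx: "\<exists>i<n. v = vs ! i" if "v \<in> verts H" for v
    using that vs(2) unfolding n_def by (metis in_set_conv_nth)
  show ?thesis
  proof (rule that[of "F x" "F y" c])
    show "\<forall>v\<in>verts H. adj_op H vw ew (F x) v = a * F x v"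
      using idx xy by (fastforce simp: TF Fi)
    show "\<forall>v\<in>verts H. adj_op H vw ew (F y) v = c * F x v + b * F y v"
      using idx xy by (fastforce simp: TF Fi)
    show "F x \<noteq> (\<lambda>_. 0)"
    proof
      assume "F x = (\<lambda>_. 0)"
      then have "x $ i = 0" if "i < n" for i using Fi[OF that, of x] by simp
      then have "x = 0\<^sub>v n" using xy(1) by (intro eq_vecI) auto
      with xy(5) show False by simp
    qed
    show "\<forall>k. F y \<noteq> (\<lambda>v. k * F x v)"
    proof (intro allI notI)
      fix k assume eq: "F y = (\<lambda>v. k * F x v)"
      have "y = k \<cdot>\<^sub>v x"
      proof (rule eq_vecI)
        fix i assume "i < dim_vec (k \<cdot>\<^sub>v x)"
        then have "i < n" using xy by simp
        then show "y $ i = (k \<cdot>\<^sub>v x) $ i" using fun_cong[OF eq, of "vs ! i"] xy by (simp add: Fi)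
      qed (use xy in auto)
      with xy(6) show False by blast
    qed
  qed (auto simp: F0)
qed

section \<open>The adjacency form\<close>

context regular_diagram
begin

text \<open>This is the form of the adjacency operator written over arcs. Tail and head enter
  symmetrically, and no prior proof that the operator preserves \<open>L2\<close> is
  required.\<close>

definition arc_form :: "('v \<Rightarrow> complex) \<Rightarrow> ('v \<Rightarrow> complex) \<Rightarrow> complex" where
  "arc_form f g = (\<Sum>\<^sub>\<infinity>e\<in>arcs G. f (tail G e) * cnj (g (head G e)) / of_nat (ew e))"

section \<open>Sums over arcs as sums over vertices\<close>

lemma arcs_Sigma: "bij_betw snd (Sigma (verts G) (in_arcs G)) (arcs G)"
  by (rule bij_betwI[of _ _ _ "\<lambda>e. (head G e, e)"]) (auto simp: in_arcs_def)

lemma arev_bij: "bij_betw arev (arcs G) (arcs G)"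
  by (rule bij_betwI[of _ _ _ arev]) auto

text \<open>By \<open>regular\<close>, the arcs ending at \<open>v\<close> have reciprocal weights
  adding up to \<open>(q + 1) / vw v\<close>; grouping the arcs by head gives the factor
  \<open>q + 1\<close>.\<close>

lemma has_sum_head:
  fixes k :: "'v \<Rightarrow> real"
  assumes S: "((\<lambda>v. k v / real (vw v)) has_sum S) (verts G)" and nn: "\<And>v. v \<in> verts G \<Longrightarrow> 0 \<le> k v"
  shows "((\<lambda>e. k (head G e) / real (ew e)) has_sum (real q + 1) * S) (arcs G)"
proof -
  have inner: "((\<lambda>e. k (head G e) / real (ew e)) has_sum (real q + 1) * (k v / real (vw v))) (in_arcs G v)"
    if v: "v \<in> verts G" for v
  proof -
    have "(\<Sum>e\<in>in_arcs G v. k (head G e) / real (ew e)) =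
        (\<Sum>e\<in>in_arcs G v. real (vw v) / real (ew e) * (k v / real (vw v)))"
      using vw_pos[OF v] by (intro sum.cong) auto
    also have "\<dots> = (real q + 1) * (k v / real (vw v))"
      unfolding sum_distrib_right[symmetric] regular[OF v] ..
    finally show ?thesis using has_sum_finite[OF finite_in_arcs[OF v]] by metis
  qed
  have out: "((\<lambda>v. (real q + 1) * (k v / real (vw v))) has_sum (real q + 1) * S) (verts G)"
    by (rule has_sum_cmult_right[OF S])
  let ?F = "\<lambda>e. k (head G e) / real (ew e)"
  \<comment> \<open>Tonelli: as \<open>k\<close> is nonnegative, convergence of the iterated sum
    gives summability over all arcs.\<close>
  have "(\<lambda>p. ?F (snd p)) summable_on Sigma (verts G) (in_arcs G)"
    by (rule summable_on_SigmaI[where g = "\<lambda>v. (real q + 1) * (k v / real (vw v))"])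
      (use inner out nn in \<open>auto simp: in_arcs_def has_sum_imp_summable\<close>)
  then obtain T where T: "((\<lambda>p. ?F (snd p)) has_sum T) (Sigma (verts G) (in_arcs G))"
    by (auto simp: summable_on_def)
  have "((\<lambda>v. (real q + 1) * (k v / real (vw v))) has_sum T) (verts G)"
    by (rule has_sum_Sigma'[OF T]) (use inner in simp)
  then have "T = (real q + 1) * S" using out by (rule has_sum_unique)
  with T show ?thesis using has_sum_reindex_bij_betw[OF arcs_Sigma, of ?F] by fastforce
qed

text \<open>Arc reversal exchanges head and tail and preserves \<open>ew\<close>.\<close>

lemma has_sum_tail:
  fixes k :: "'v \<Rightarrow> real"
  assumes S: "((\<lambda>v. k v / real (vw v)) has_sum S) (verts G)" and nn: "\<And>v. v \<in> verts G \<Longrightarrow> 0 \<le> k v"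
  shows "((\<lambda>e. k (tail G e) / real (ew e)) has_sum (real q + 1) * S) (arcs G)"
proof -
  have "((\<lambda>e. k (head G (arev e)) / real (ew (arev e))) has_sum (real q + 1) * S) (arcs G)"
    using has_sum_head[OF S nn] by (subst has_sum_reindex_bij_betw[OF arev_bij])
  then show ?thesis by (rule has_sum_cong[THEN iffD1, rotated]) (simp add: ew_arev)
qed

section \<open>Square summability and the bound by q + 1\<close>

lemma L2_sq_has_sum:
  assumes "f \<in> L2 G vw"
  shows "((\<lambda>v. (cmod (f v))\<^sup>2 / real (vw v)) has_sum Re (l2_inner G vw f f)) (verts G)"
    and "Im (l2_inner G vw f f) = 0" and "0 \<le> Re (l2_inner G vw f f)"
proof -
  obtain S where S: "((\<lambda>v. (cmod (f v))\<^sup>2 / real (vw v)) has_sum S) (verts G)"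
    using assms by (auto simp: L2_def summable_on_def)
  have "((\<lambda>v. complex_of_real ((cmod (f v))\<^sup>2 / real (vw v))) has_sum of_real S) (verts G)"
    by (rule has_sum_of_real[OF S])
  then have "((\<lambda>v. f v * cnj (f v) / of_nat (vw v)) has_sum of_real S) (verts G)"
    by (simp add: complex_norm_square del: of_real_power)
  then have eq: "l2_inner G vw f f = of_real S" unfolding l2_inner_def by (rule infsumI)
  then show "((\<lambda>v. (cmod (f v))\<^sup>2 / real (vw v)) has_sum Re (l2_inner G vw f f)) (verts G)"
    and "Im (l2_inner G vw f f) = 0" using S by auto
  show "0 \<le> Re (l2_inner G vw f f)"
    unfolding eq using has_sum_nonneg[OF S] by simp
qed

text \<open>The inequality of arithmetic and geometric means, in the shape that dominates both the
  vertex series of the inner product and the arc series of \<open>arc_form\<close>.\<close>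

lemma norm_product_bound:
  fixes x y :: complex and k :: nat
  shows "cmod (x * cnj y / of_nat k) \<le> (cmod x)\<^sup>2 / real k / 2 + (cmod y)\<^sup>2 / real k / 2"
proof -
  have "0 \<le> (cmod x - cmod y)\<^sup>2" by simp
  then have "cmod x * cmod y \<le> ((cmod x)\<^sup>2 + (cmod y)\<^sup>2) / 2"
    by (simp add: power2_diff)
  then have "cmod x * cmod y / real k \<le> ((cmod x)\<^sup>2 + (cmod y)\<^sup>2) / 2 / real k"
    by (rule divide_right_mono) simp
  then show ?thesis by (simp add: norm_mult norm_divide add_divide_distrib mult.commute)
qed

lemma l2_summable:
  assumes "f \<in> L2 G vw" "g \<in> L2 G vw"
  shows "(\<lambda>v. f v * cnj (g v) / of_nat (vw v)) summable_on verts G"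
proof (rule abs_summable_summable, rule abs_summable_on_comparison_test')
  show "(\<lambda>v. (cmod (f v))\<^sup>2 / real (vw v) / 2 + (cmod (g v))\<^sup>2 / real (vw v) / 2) summable_on verts G"
    using L2_sq_has_sum(1)[OF assms(1)] L2_sq_has_sum(1)[OF assms(2)]
    by (intro summable_on_add has_sum_imp_summable[OF has_sum_divide_const])
qed (rule norm_product_bound)

lemma arc_bound_has_sum:
  assumes "f \<in> L2 G vw" "g \<in> L2 G vw"
  shows "((\<lambda>e. (cmod (f (tail G e)))\<^sup>2 / real (ew e) / 2 + (cmod (g (head G e)))\<^sup>2 / real (ew e) / 2)
    has_sum (real q + 1) * Re (l2_inner G vw f f) / 2 + (real q + 1) * Re (l2_inner G vw g g) / 2) (arcs G)"
  using has_sum_tail[OF L2_sq_has_sum(1)[OF assms(1)]] has_sum_head[OF L2_sq_has_sum(1)[OF assms(2)]]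
  by (intro has_sum_add has_sum_divide_const) auto

lemma arc_abs_summable:
  assumes "f \<in> L2 G vw" "g \<in> L2 G vw"
  shows "(\<lambda>e. norm (f (tail G e) * cnj (g (head G e)) / of_nat (ew e))) summable_on arcs G"
  by (rule abs_summable_on_comparison_test'[OF has_sum_imp_summable[OF arc_bound_has_sum[OF assms]]])
    (rule norm_product_bound)

lemmas arc_summable = abs_summable_summable[OF arc_abs_summable]

text \<open>With equal arguments, the tail half and the head half of the dominating series together
  give \<open>q + 1\<close> times the squared norm. Both outer eigenvalue bounds come from
  this.\<close>

lemma arc_form_bound:
  assumes "f \<in> L2 G vw"
  shows "\<bar>Re (arc_form f f)\<bar> \<le> (real q + 1) * Re (l2_inner G vw f f)"
proof -
  have "cmod (arc_form f f) \<le> (real q + 1) * Re (l2_inner G vw f f) / 2 + (real q + 1) * Re (l2_inner G vw f f) / 2"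
    unfolding arc_form_def
    by (rule norm_infsum_le[OF has_sum_infsum[OF arc_summable] arc_bound_has_sum])
      (use assms norm_product_bound in auto)
  then show ?thesis using abs_Re_le_cmod[of "arc_form f f"] by simp
qed

text \<open>The factor \<open>vw v\<close> in the operator cancels the weight in the inner product,
  and summability over the arcs allows regrouping them by head.\<close>

lemma l2_inner_adj_op:
  assumes "f \<in> L2 G vw" "g \<in> L2 G vw"
  shows "l2_inner G vw (adj_op G vw ew f) g = arc_form f g"
proof -
  let ?F = "\<lambda>e. f (tail G e) * cnj (g (head G e)) / of_nat (ew e)"
  have "(?F has_sum arc_form f g) (arcs G)"
    unfolding arc_form_def by (rule has_sum_infsum[OF arc_summable[OF assms]])
  then have hs: "((\<lambda>p. ?F (snd p)) has_sum arc_form f g) (Sigma (verts G) (in_arcs G))"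
    using has_sum_reindex_bij_betw[OF arcs_Sigma, of ?F] by fastforce
  have "((\<lambda>v. adj_op G vw ew f v * cnj (g v) / of_nat (vw v)) has_sum arc_form f g) (verts G)"
  proof (rule has_sum_Sigma'[OF hs])
    fix v assume v: "v \<in> verts G"
    have "adj_op G vw ew f v * cnj (g v) / of_nat (vw v) = (\<Sum>e\<in>in_arcs G v. ?F e)"
      unfolding adj_op_def sum_distrib_right sum_divide_distrib
      using vw_pos[OF v] by (intro sum.cong) auto
    then show "((\<lambda>e. ?F (snd (v, e))) has_sum adj_op G vw ew f v * cnj (g v) / of_nat (vw v)) (in_arcs G v)"
      using has_sum_finite[OF finite_in_arcs[OF v], of ?F] by simp
  qed
  then show ?thesis unfolding l2_inner_def by (rule infsumI)
qed

section \<open>Hermitian symmetry and sesquilinearity\<close>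

text \<open>Reindexing by arc reversal swaps the roles of the two arguments.\<close>

lemma arc_form_hermitian: "arc_form g f = cnj (arc_form f g)"
proof -
  have "arc_form g f = (\<Sum>\<^sub>\<infinity>e\<in>arcs G. g (tail G (arev e)) * cnj (f (head G (arev e))) / of_nat (ew (arev e)))"
    unfolding arc_form_def by (rule infsum_reindex_bij_betw[OF arev_bij, symmetric])
  also have "\<dots> = (\<Sum>\<^sub>\<infinity>e\<in>arcs G. cnj (f (tail G e) * cnj (g (head G e)) / of_nat (ew e)))"
    by (rule infsum_cong) (simp add: ew_arev)
  also have "\<dots> = cnj (arc_form f g)" unfolding arc_form_def by (rule infsum_cnj)
  finally show ?thesis .
qed

lemma l2_inner_hermitian: "l2_inner G vw g f = cnj (l2_inner G vw f g)"
  unfolding l2_inner_def infsum_cnj[symmetric] by (rule infsum_cong) simp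

text \<open>The bound is \<open>(x + y)^2 \<le> 2 x^2 + 2 y^2\<close>. One shape of linear
  combination serves throughout; this is why later definitions carry coefficients such as
  \<open>1 *\<close> or \<open>0 *\<close>.\<close>

lemma L2_lin:
  assumes "f \<in> L2 G vw" "g \<in> L2 G vw"
  shows "(\<lambda>v. a * f v + b * g v) \<in> L2 G vw"
proof -
  have "(\<lambda>v. 2 * (cmod a)\<^sup>2 * ((cmod (f v))\<^sup>2 / real (vw v)) + 2 * (cmod b)\<^sup>2 * ((cmod (g v))\<^sup>2 / real (vw v)))
      summable_on verts G"
    using assms by (intro summable_on_add summable_on_cmult_right) (auto simp: L2_def)
  then have "(\<lambda>v. (cmod (a * f v + b * g v))\<^sup>2 / real (vw v)) summable_on verts G"
  proof (rule summable_on_comparison_test)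
    fix v
    have "(cmod (a * f v + b * g v))\<^sup>2 \<le> (cmod a * cmod (f v) + cmod b * cmod (g v))\<^sup>2"
      by (rule power_mono) (use norm_triangle_ineq[of "a * f v" "b * g v"] in \<open>auto simp: norm_mult\<close>)
    also have "\<dots> \<le> 2 * (cmod a * cmod (f v))\<^sup>2 + 2 * (cmod b * cmod (g v))\<^sup>2"
      using zero_le_power2[of "cmod a * cmod (f v) - cmod b * cmod (g v)"]
      by (simp add: power2_sum power2_diff)
    finally have "(cmod (a * f v + b * g v))\<^sup>2 / real (vw v) \<le>
        (2 * (cmod a * cmod (f v))\<^sup>2 + 2 * (cmod b * cmod (g v))\<^sup>2) / real (vw v)"
      by (rule divide_right_mono) simp
    then show "(cmod (a * f v + b * g v))\<^sup>2 / real (vw v) \<le>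
        2 * (cmod a)\<^sup>2 * ((cmod (f v))\<^sup>2 / real (vw v)) + 2 * (cmod b)\<^sup>2 * ((cmod (g v))\<^sup>2 / real (vw v))"
      by (simp add: add_divide_distrib power_mult_distrib)
  qed simp
  then show ?thesis using assms by (auto simp: L2_def)
qed

lemma l2_inner_lin_left:
  assumes "f \<in> L2 G vw" "g \<in> L2 G vw" "h \<in> L2 G vw"
  shows "l2_inner G vw (\<lambda>v. a * f v + b * g v) h = a * l2_inner G vw f h + b * l2_inner G vw g h"
proof -
  have "((\<lambda>v. a * (f v * cnj (h v) / of_nat (vw v)) + b * (g v * cnj (h v) / of_nat (vw v)))
     has_sum a * l2_inner G vw f h + b * l2_inner G vw g h) (verts G)"
    unfolding l2_inner_def
    using assms by (intro has_sum_add has_sum_cmult_right has_sum_infsum l2_summable)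
  then show ?thesis unfolding l2_inner_def
    by (intro infsumI) (simp add: add_divide_distrib distrib_right mult.assoc)
qed

lemma l2_inner_lin_right:
  assumes "f \<in> L2 G vw" "g \<in> L2 G vw" "h \<in> L2 G vw"
  shows "l2_inner G vw h (\<lambda>v. a * f v + b * g v) = cnj a * l2_inner G vw h f + cnj b * l2_inner G vw h g"
  by (metis (no_types) l2_inner_hermitian l2_inner_lin_left[OF assms] complex_cnj_add complex_cnj_mult)

lemma arc_form_lin_left:
  assumes "f \<in> L2 G vw" "g \<in> L2 G vw" "h \<in> L2 G vw"
  shows "arc_form (\<lambda>v. a * f v + b * g v) h = a * arc_form f h + b * arc_form g h"
proof -
  have "((\<lambda>e. a * (f (tail G e) * cnj (h (head G e)) / of_nat (ew e)) +
      b * (g (tail G e) * cnj (h (head G e)) / of_nat (ew e)))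
     has_sum a * arc_form f h + b * arc_form g h) (arcs G)"
    unfolding arc_form_def
    using assms by (intro has_sum_add has_sum_cmult_right has_sum_infsum arc_summable)
  then show ?thesis unfolding arc_form_def
    by (intro infsumI) (simp add: add_divide_distrib distrib_right mult.assoc)
qed

lemma arc_form_lin_right:
  assumes "f \<in> L2 G vw" "g \<in> L2 G vw" "h \<in> L2 G vw"
  shows "arc_form h (\<lambda>v. a * f v + b * g v) = cnj a * arc_form h f + cnj b * arc_form h g"
  by (metis (no_types) arc_form_hermitian arc_form_lin_left[OF assms] complex_cnj_add complex_cnj_mult)

lemma l2_inner_pos:
  assumes f: "f \<in> L2 G vw" and ne: "f \<noteq> (\<lambda>_. 0)"
  shows "0 < Re (l2_inner G vw f f)"
proof (rule ccontr)
  assume "\<not> ?thesis"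
  then have "Re (l2_inner G vw f f) = 0" using L2_sq_has_sum(3)[OF f] by simp
  then have hs: "((\<lambda>v. (cmod (f v))\<^sup>2 / real (vw v)) has_sum 0) (verts G)" using L2_sq_has_sum(1)[OF f] by simp
  obtain v where v: "f v \<noteq> 0" using ne by auto
  then have "v \<in> verts G" using f by (auto simp: L2_def)
  then have "(cmod (f v))\<^sup>2 / real (vw v) = 0"
    by (intro nonneg_has_sum_le_0D[OF hs]) auto
  then show False using v vw_pos[OF \<open>v \<in> verts G\<close>] by simp
qed

section \<open>The trivial eigenfunctions\<close>

definition sign_fun :: "real \<Rightarrow> 'v \<Rightarrow> complex" where
  "sign_fun s v = (if v \<in> VI then 1 else if v \<in> VO then of_real s else 0)"

text \<open>Finite volume enters here: it makes bounded functions square summable.\<close>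

lemma sign_fun_L2: "sign_fun s \<in> L2 G vw"
proof -
  have "(\<lambda>v. max 1 (s\<^sup>2) * (1 / real (vw v))) summable_on verts G"
    using finite_volume by (rule summable_on_cmult_right)
  then have "(\<lambda>v. (cmod (sign_fun s v))\<^sup>2 / real (vw v)) summable_on verts G"
    by (rule summable_on_comparison_test)
      (auto simp: sign_fun_def max_def intro!: divide_right_mono)
  then show ?thesis using verts_partition by (auto simp: L2_def sign_fun_def)
qed

lemma sign_fun_neighbour:
  assumes "e \<in> arcs G" "s = 1 \<or> s = - 1"
  shows "sign_fun s (tail G e) = of_real s * sign_fun s (head G e)"
  using arcs_bipartite[OF assms(1)] verts_partition(2) assms(2) by (auto simp: sign_fun_def)

lemma adj_op_sign_fun:
  assumes v: "v \<in> verts G" and s: "s = 1 \<or> s = - 1"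
  shows "adj_op G vw ew (sign_fun s) v = of_real (s * (real q + 1)) * sign_fun s v"
proof -
  have "adj_op G vw ew (sign_fun s) v =
      (\<Sum>e\<in>in_arcs G v. complex_of_real (real (vw v) / real (ew e)) * (of_real s * sign_fun s v))"
    unfolding adj_op_def by (rule sum.cong) (auto simp: sign_fun_neighbour s)
  also have "\<dots> = of_real (\<Sum>e\<in>in_arcs G v. real (vw v) / real (ew e)) * (of_real s * sign_fun s v)"
    by (simp only: of_real_sum sum_distrib_right)
  also have "\<dots> = of_real (real q + 1) * (of_real s * sign_fun s v)" by (simp only: regular[OF v])
  finally show ?thesis by simp
qed

text \<open>The eigenvalue equation in weak form: orthogonality to \<open>sign_fun s\<close> for the
  inner product becomes orthogonality for \<open>arc_form\<close>.\<close>

lemma arc_form_sign_fun: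
  assumes g: "g \<in> L2 G vw" and s: "s = 1 \<or> s = - 1"
  shows "arc_form (sign_fun s) g = of_real (s * (real q + 1)) * l2_inner G vw (sign_fun s) g"
proof -
  have "arc_form (sign_fun s) g = l2_inner G vw (adj_op G vw ew (sign_fun s)) g"
    by (rule l2_inner_adj_op[OF sign_fun_L2 g, symmetric])
  also have "\<dots> = (\<Sum>\<^sub>\<infinity>v\<in>verts G. of_real (s * (real q + 1)) * (sign_fun s v * cnj (g v) / of_nat (vw v)))"
    unfolding l2_inner_def by (rule infsum_cong) (simp add: adj_op_sign_fun s)
  also have "\<dots> = of_real (s * (real q + 1)) * l2_inner G vw (sign_fun s) g"
    unfolding l2_inner_def by (rule infsum_cmult_right) (simp add: l2_summable g sign_fun_L2)
  finally show ?thesis .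
qed

text \<open>Eigenfunctions of a Hermitian form for the distinct eigenvalues \<open>q + 1\<close> and
  \<open>- (q + 1)\<close> are orthogonal. Equivalently, \<open>VI\<close> and \<open>VO\<close>
  have the same volume.\<close>

lemma sign_fun_orthogonal:
  assumes s: "s = 1 \<or> s = - 1"
  shows "l2_inner G vw (sign_fun s) (sign_fun (- s)) = 0"
proof -
  let ?x = "l2_inner G vw (sign_fun s) (sign_fun (- s))"
  have "of_real (s * (real q + 1)) * ?x = arc_form (sign_fun s) (sign_fun (- s))"
    by (rule arc_form_sign_fun[OF sign_fun_L2 s, symmetric])
  also have "\<dots> = cnj (arc_form (sign_fun (- s)) (sign_fun s))" by (rule arc_form_hermitian)
  also have "\<dots> = cnj (of_real (- s * (real q + 1)) * l2_inner G vw (sign_fun (- s)) (sign_fun s))"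
    using s by (subst arc_form_sign_fun[OF sign_fun_L2]) auto
  also have "\<dots> = - of_real (s * (real q + 1)) * ?x"
    by (subst l2_inner_hermitian) simp
  finally have "of_real (2 * (s * (real q + 1))) * ?x = 0" by (simp add: algebra_simps)
  moreover have "2 * (s * (real q + 1)) \<noteq> 0" using s by auto
  ultimately show ?thesis by (metis mult_eq_0_iff of_real_eq_0_iff)
qed

lemma l2_inner_sign_fun:
  assumes f: "f \<in> L2 G vw"
  shows "l2_inner G vw f (sign_fun s) =
    (\<Sum>\<^sub>\<infinity>v\<in>VI. f v / of_nat (vw v)) + of_real s * (\<Sum>\<^sub>\<infinity>v\<in>VO. f v / of_nat (vw v))"
proof -
  let ?F = "\<lambda>s v. f v * cnj (sign_fun s v) / of_nat (vw v)"
  have sm: "?F s summable_on A" if "A \<subseteq> verts G" for s A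
    by (rule summable_on_subset_banach[OF l2_summable[OF f sign_fun_L2] that])
  \<comment> \<open>For parameter 1 the sign function is 1 on \<open>VO\<close>, so this is a
    restriction of a summable inner product.\<close>
  have O: "(\<lambda>v. f v / of_nat (vw v)) summable_on VO"
  proof (rule summable_on_cong[THEN iffD1])
    show "?F 1 summable_on VO" using sm verts_partition by auto
  qed (use verts_partition in \<open>auto simp: sign_fun_def\<close>)
  have "l2_inner G vw f (sign_fun s) = infsum (?F s) VI + infsum (?F s) VO"
    unfolding l2_inner_def using verts_partition sm[of VI s] sm[of VO s]
    by (subst verts_partition(1), subst Un_commute, subst infsum_Un_disjoint) auto
  also have "infsum (?F s) VI = (\<Sum>\<^sub>\<infinity>v\<in>VI. f v / of_nat (vw v))"
    by (rule infsum_cong) (simp add: sign_fun_def)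
  also have "infsum (?F s) VO = (\<Sum>\<^sub>\<infinity>v\<in>VO. of_real s * (f v / of_nat (vw v)))"
    using verts_partition(2) by (intro infsum_cong) (auto simp: sign_fun_def)
  also have "\<dots> = of_real s * (\<Sum>\<^sub>\<infinity>v\<in>VO. f v / of_nat (vw v))"
    by (rule infsum_cmult_right) (rule O)
  finally show ?thesis .
qed

text \<open>If \<open>x\<close> and \<open>y\<close> are the sums over \<open>VI\<close> and
  \<open>VO\<close>, the two inner products are \<open>x + s y\<close> and \<open>x - s y\<close>;
  both vanish exactly when \<open>x = y = 0\<close>.\<close>

lemma L20_iff:
  assumes s: "s = 1 \<or> s = - 1"
  shows "f \<in> L20 G VO VI vw \<longleftrightarrow> f \<in> L2 G vw \<and>
    l2_inner G vw f (sign_fun s) = 0 \<and> l2_inner G vw f (sign_fun (- s)) = 0"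
  using s by (auto simp: L20_def l2_inner_sign_fun add_eq_0_iff)

text \<open>Write \<open>h\<close> as \<open>h0\<close> plus a multiple of
  \<open>sign_fun s\<close>, with \<open>h0\<close> in \<open>L20\<close>. Norm and form both split
  along this sum, and on the second summand \<open>s\<close> times the form equals
  \<open>q + 1\<close> times the squared norm, which is at least \<kappa> times it.\<close>

lemma arc_form_ge_of_L20:
  assumes s: "s = 1 \<or> s = - 1"
    and ne: "verts G \<noteq> {}"
    and h: "h \<in> L2 G vw" "l2_inner G vw h (sign_fun (- s)) = 0"
    and bd: "\<And>f. f \<in> L20 G VO VI vw \<Longrightarrow> \<kappa> * Re (l2_inner G vw f f) \<le> s * Re (arc_form f f)"
    and mu: "\<kappa> \<le> real q + 1"
  shows "\<kappa> * Re (l2_inner G vw h h) \<le> s * Re (arc_form h h)"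
proof -
  let ?\<phi> = "sign_fun s"
  define W where "W = Re (l2_inner G vw ?\<phi> ?\<phi>)"
  have \<phi>: "?\<phi> \<in> L2 G vw" by (rule sign_fun_L2)
  have "?\<phi> \<noteq> (\<lambda>_. 0)"
  proof
    assume z: "?\<phi> = (\<lambda>_. 0)"
    obtain v where "v \<in> verts G" using ne by auto
    then show False using fun_cong[OF z, of v] verts_partition s by (auto simp: sign_fun_def split: if_splits)
  qed
  then have W: "0 < W" unfolding W_def by (rule l2_inner_pos[OF \<phi>])
  have W_eq: "l2_inner G vw ?\<phi> ?\<phi> = of_real W"
    using L2_sq_has_sum(2)[OF \<phi>] by (simp add: W_def complex_eq_iff)
  \<comment> \<open>The coefficient of the orthogonal projection of \<open>h\<close> to
    \<open>sign_fun s\<close>.\<close>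
  define a where "a = l2_inner G vw h ?\<phi> / of_real W"
  have h\<phi>: "l2_inner G vw h ?\<phi> = a * of_real W" using W by (simp add: a_def)
  then have \<phi>h: "l2_inner G vw ?\<phi> h = cnj a * of_real W"
    by (subst l2_inner_hermitian) simp
  define h0 where "h0 = (\<lambda>v. 1 * h v + (- a) * ?\<phi> v)"
  have h0: "h0 \<in> L2 G vw" unfolding h0_def by (rule L2_lin[OF h(1) \<phi>])
  have h0\<phi>: "l2_inner G vw h0 ?\<phi> = 0"
    unfolding h0_def l2_inner_lin_left[OF h(1) \<phi> \<phi>] by (simp add: h\<phi> W_eq)
  have "l2_inner G vw h0 (sign_fun (- s)) = 0"
    unfolding h0_def l2_inner_lin_left[OF h(1) \<phi> sign_fun_L2] by (simp add: h(2) sign_fun_orthogonal[OF s])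
  with h0 h0\<phi> have L20: "h0 \<in> L20 G VO VI vw" by (simp add: L20_iff[OF s])
  have aa: "a * cnj a = of_real ((cmod a)\<^sup>2)" by (rule complex_norm_square[symmetric])
  have "l2_inner G vw h0 h0 = l2_inner G vw h0 h"
    using l2_inner_lin_right[OF h(1) \<phi> h0, of 1 "- a", folded h0_def] by (simp add: h0\<phi>)
  also have "\<dots> = l2_inner G vw h h - (a * cnj a) * of_real W"
    unfolding h0_def l2_inner_lin_left[OF h(1) \<phi> h(1)] by (simp add: \<phi>h)
  finally have n0: "Re (l2_inner G vw h0 h0) = Re (l2_inner G vw h h) - (cmod a)\<^sup>2 * W"
    by (simp add: aa del: of_real_power)
  \<comment> \<open>The weak eigenvalue equation turns this into orthogonality for the form, so the
    mixed terms vanish.\<close>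
  have "l2_inner G vw ?\<phi> h0 = 0" using h0\<phi> by (subst l2_inner_hermitian) simp
  then have "arc_form h0 ?\<phi> = 0"
    by (subst arc_form_hermitian) (simp add: arc_form_sign_fun[OF h0 s])
  then have "arc_form h0 h0 = arc_form h0 h"
    using arc_form_lin_right[OF h(1) \<phi> h0, of 1 "- a", folded h0_def] by simp
  also have "\<dots> = arc_form h h - of_real (s * (real q + 1)) * ((a * cnj a) * of_real W)"
    unfolding h0_def arc_form_lin_left[OF h(1) \<phi> h(1)] arc_form_sign_fun[OF h(1) s] by (simp add: \<phi>h)
  also have "\<dots> = arc_form h h - of_real (s * (real q + 1) * ((cmod a)\<^sup>2 * W))"
    unfolding aa by (simp del: of_real_power)
  finally have q0: "Re (arc_form h0 h0) = Re (arc_form h h) - s * (real q + 1) * ((cmod a)\<^sup>2 * W)"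
    by (metis minus_complex.simps(1) Re_complex_of_real)
  \<comment> \<open>The sign in front of the form cancels the sign of the eigenvalue, so the removed
    component counts with \<open>+ (q + 1)\<close> in both cases.\<close>
  have "s * s = 1" using s by auto
  then have "s * Re (arc_form h0 h0) = s * Re (arc_form h h) - (real q + 1) * ((cmod a)\<^sup>2 * W)"
    unfolding q0 by (simp add: right_diff_distrib mult.assoc[symmetric])
  moreover have "\<kappa> * ((cmod a)\<^sup>2 * W) \<le> (real q + 1) * ((cmod a)\<^sup>2 * W)"
    using W mu by (intro mult_right_mono) auto
  ultimately show ?thesis using bd[OF L20] unfolding n0 by (simp add: right_diff_distrib)
qed

section \<open>The constants m and M\<close>

text \<open>Boundedness on both sides makes \<open>Inf\<close> and \<open>Sup\<close> genuine bounds
  in \<open>m_const\<close> and \<open>M_const\<close>.\<close>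

lemma quad_values_bound:
  assumes "x \<in> quad_values G VO VI vw ew"
  shows "\<bar>x\<bar> \<le> real q + 1"
proof -
  obtain f where f: "f \<in> L2 G vw" "l2_norm G vw f = 1"
    and x: "x = Re (l2_inner G vw (adj_op G vw ew f) f)"
    using assms by (auto simp: quad_values_def L20_def)
  have "Re (l2_inner G vw f f) = 1" using f(2) by (simp add: l2_norm_def real_sqrt_eq_1_iff)
  then show ?thesis using arc_form_bound[OF f(1)] x by (simp add: l2_inner_adj_op f(1))
qed

lemma zero_L2: "(\<lambda>_. 0) \<in> L2 G vw"
  by (simp add: L2_def)

lemma zero_L20: "(\<lambda>_. 0) \<in> L20 G VO VI vw"
  by (simp add: L20_def zero_L2)

lemma rayleigh_in_quad_values:
  assumes f: "f \<in> L20 G VO VI vw" and ne: "f \<noteq> (\<lambda>_. 0)"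
  shows "Re (arc_form f f) / Re (l2_inner G vw f f) \<in> quad_values G VO VI vw ew"
proof -
  have f2: "f \<in> L2 G vw" using f by (simp add: L20_def)
  define N where "N = Re (l2_inner G vw f f)"
  have N: "0 < N" unfolding N_def by (rule l2_inner_pos[OF f2 ne])
  define c where "c = complex_of_real (1 / sqrt N)"
  define g where "g = (\<lambda>v. c * f v + 0 * f v)"
  have g2: "g \<in> L2 G vw" unfolding g_def by (rule L2_lin[OF f2 f2])
  have "l2_inner G vw g (sign_fun s) = 0" if "s = 1 \<or> s = - 1" for s
    unfolding g_def l2_inner_lin_left[OF f2 f2 sign_fun_L2] using f L20_iff[OF that] by simp
  then have g: "g \<in> L20 G VO VI vw" using g2 L20_iff[of 1] by simp
  have cc: "c * cnj c = of_real (1 / N)" using N by (simp add: c_def flip: of_real_mult)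
  have "l2_inner G vw g g = (c * cnj c) * l2_inner G vw f f"
    using l2_inner_lin_right[OF f2 f2 g2, of c 0, folded g_def] l2_inner_lin_left[OF f2 f2 f2, of c 0, folded g_def]
    by simp
  then have "Re (l2_inner G vw g g) = 1" unfolding cc using N by (simp add: N_def)
  then have g1: "l2_norm G vw g = 1" by (simp add: l2_norm_def)
  have "arc_form g g = (c * cnj c) * arc_form f f"
    using arc_form_lin_right[OF f2 f2 g2, of c 0, folded g_def] arc_form_lin_left[OF f2 f2 f2, of c 0, folded g_def]
    by simp
  then have "Re (arc_form f f) / N = Re (l2_inner G vw (adj_op G vw ew g) g)"
    unfolding l2_inner_adj_op[OF g2 g2] cc by simp
  then show ?thesis using g g1 unfolding N_def quad_values_def by blast
qed

text \<open>A nonzero element of \<open>L20\<close> makes \<open>quad_values\<close> nonempty, and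
  scaling turns bounds on unit vectors into homogeneous ones. The first two claims supply the
  condition \<kappa> \<le> q + 1 for \<kappa> = m and for \<kappa> = -M.\<close>

lemma m_const_M_const_bounds:
  assumes ne: "L20 G VO VI vw \<noteq> {\<lambda>_. 0}"
  shows "m_const G VO VI vw ew \<le> real q + 1" "- (real q + 1) \<le> M_const G VO VI vw ew"
    and "f \<in> L20 G VO VI vw \<Longrightarrow> m_const G VO VI vw ew * Re (l2_inner G vw f f) \<le> Re (arc_form f f)"
    and "f \<in> L20 G VO VI vw \<Longrightarrow> Re (arc_form f f) \<le> M_const G VO VI vw ew * Re (l2_inner G vw f f)"
proof -
  let ?S = "quad_values G VO VI vw ew"
  have bd: "- (real q + 1) \<le> x" "x \<le> real q + 1" if "x \<in> ?S" for x
    using quad_values_bound[OF that] by auto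
  have below: "bdd_below ?S" and above: "bdd_above ?S"
    using bdd_belowI[of ?S, OF bd(1)] bdd_aboveI[of ?S, OF bd(2)] by auto
  obtain f where "f \<in> L20 G VO VI vw" "f \<noteq> (\<lambda>_. 0)" using ne zero_L20 by blast
  then obtain x where x: "x \<in> ?S" using rayleigh_in_quad_values by blast
  show "m_const G VO VI vw ew \<le> real q + 1"
    unfolding m_const_def using cInf_lower[OF x below] bd[OF x] by linarith
  show "- (real q + 1) \<le> M_const G VO VI vw ew"
    unfolding M_const_def using cSup_upper[OF x above] bd[OF x] by linarith
  fix f assume f: "f \<in> L20 G VO VI vw"
  have "m_const G VO VI vw ew * Re (l2_inner G vw f f) \<le> Re (arc_form f f) \<and>
      Re (arc_form f f) \<le> M_const G VO VI vw ew * Re (l2_inner G vw f f)"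
  proof (cases "f = (\<lambda>_. 0)")
    case True
    then show ?thesis by (simp add: l2_inner_def arc_form_def)
  next
    case False
    have f2: "f \<in> L2 G vw" using f by (simp add: L20_def)
    have N: "0 < Re (l2_inner G vw f f)" by (rule l2_inner_pos[OF f2 False])
    note R = rayleigh_in_quad_values[OF f False]
    show ?thesis
      using cInf_lower[OF R below] cSup_upper[OF R above] N
      by (simp add: m_const_def M_const_def pos_le_divide_eq pos_divide_le_eq)
  qed
  then show "m_const G VO VI vw ew * Re (l2_inner G vw f f) \<le> Re (arc_form f f)"
    and "Re (arc_form f f) \<le> M_const G VO VI vw ew * Re (l2_inner G vw f f)" by auto
qed

section \<open>Comparison with a finite induced subgraph\<close>

lemma finite_support_L2:
  assumes "finite S" "S \<subseteq> verts G" "\<And>v. v \<notin> S \<Longrightarrow> f v = 0"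
  shows "f \<in> L2 G vw"
proof -
  have "{v \<in> verts G. (cmod (f v))\<^sup>2 / real (vw v) \<noteq> 0} \<subseteq> S" using assms(3) by auto
  then have "finite {v \<in> verts G. (cmod (f v))\<^sup>2 / real (vw v) \<noteq> 0}"
    using assms(1) finite_subset by blast
  then show ?thesis
    using assms by (auto simp: L2_def intro!: finite_nonzero_values_imp_summable_on)
qed

text \<open>At a vertex of \<open>H\<close>, arcs from outside \<open>H\<close> contribute nothing
  because \<open>f\<close> vanishes there, and all other incoming arcs belong to \<open>H\<close>
  since it is induced. Off \<open>H\<close> the factor \<open>g\<close> is zero. The parameter
  \<open>u\<close> lets eigenvalue equations be substituted directly.\<close>

lemma arc_form_induced:
  assumes ind: "induced_subgraph H G" and fin: "finite (verts H)"
    and f: "\<And>v. v \<notin> verts H \<Longrightarrow> f v = 0" and g: "\<And>v. v \<notin> verts H \<Longrightarrow> g v = 0"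
    and u: "\<And>v. v \<in> verts H \<Longrightarrow> adj_op H vw ew f v = u v"
  shows "arc_form f g = l2_inner G vw u g"
proof -
  have compat: "subgraph H G" "compatible G H"
    and arcsH: "arcs H = {e \<in> arcs G. tail G e \<in> verts H \<and> head G e \<in> verts H}"
    using ind unfolding induced_subgraph_def subgraph_def by iprover+
  have sub: "verts H \<subseteq> verts G" "tail H = tail G" "head H = head G"
    using compat unfolding subgraph_def compatible_def by (iprover intro: sym)+
  have L: "f \<in> L2 G vw" "g \<in> L2 G vw" using finite_support_L2[OF fin sub(1)] f g by blast+
  have adj: "adj_op G vw ew f v = u v" if v: "v \<in> verts H" for v
  proof -
    have "adj_op G vw ew f v = adj_op H vw ew f v"
      unfolding adj_op_def sub(2)
      using finite_in_arcs[of v] v sub f by (intro sum.mono_neutral_right) (auto simp: in_arcs_def arcsH)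
    then show ?thesis by (simp add: u v)
  qed
  have "arc_form f g = l2_inner G vw (adj_op G vw ew f) g" by (rule l2_inner_adj_op[OF L, symmetric])
  also have "\<dots> = l2_inner G vw u g"
    unfolding l2_inner_def
  proof (rule infsum_cong)
    fix v show "adj_op G vw ew f v * cnj (g v) / of_nat (vw v) = u v * cnj (g v) / of_nat (vw v)"
      using adj[of v] g[of v] by (cases "v \<in> verts H") auto
  qed
  finally show ?thesis .
qed

text \<open>Gram-Schmidt applied to the triangular pair: the term with \<open>c\<close> is a
  multiple of \<open>f\<close>, hence orthogonal to the new second function. Only the values of the
  forms are recorded.\<close>

lemma two_orthogonal_eigenfunctions:
  fixes a b :: real
  assumes ind: "induced_subgraph H G" and fin: "fin_digraph H"
    and vs: "distinct vs" "set vs = verts H"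
    and cp: "char_poly (op_matrix vs (adj_op H vw ew)) = (\<Prod>x\<leftarrow>a # b # es. [:- complex_of_real x, 1:])"
  obtains f g where "f \<in> L2 G vw" "g \<in> L2 G vw" "f \<noteq> (\<lambda>_. 0)" "g \<noteq> (\<lambda>_. 0)"
    "l2_inner G vw f g = 0" "arc_form f f = of_real a * l2_inner G vw f f"
    "arc_form f g = 0" "arc_form g g = of_real b * l2_inner G vw g g"
proof -
  interpret H: fin_digraph H by (rule fin)
  have sub: "verts H \<subseteq> verts G"
    using ind unfolding induced_subgraph_def subgraph_def by iprover
  have cp': "char_poly (op_matrix vs (adj_op H vw ew)) =
      (\<Prod>x\<leftarrow>complex_of_real a # complex_of_real b # map of_real es. [:- x, 1:])"
    unfolding cp by (simp add: o_def)
  obtain f g c where fg: "\<forall>v. v \<notin> verts H \<longrightarrow> f v = 0" "\<forall>v. v \<notin> verts H \<longrightarrow> g v = 0"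
    "\<forall>v\<in>verts H. adj_op H vw ew f v = of_real a * f v"
    "\<forall>v\<in>verts H. adj_op H vw ew g v = c * f v + of_real b * g v"
    "f \<noteq> (\<lambda>_. 0)" "\<forall>k. g \<noteq> (\<lambda>v. k * f v)"
    by (rule eigenfunction_pair[OF H.finite_arcs H.tail_in_verts vs cp'])
  note f = fg(1)[rule_format] and g = fg(2)[rule_format] and Tf = fg(3)[rule_format]
    and Tg = fg(4)[rule_format] and ne = fg(5) fg(6)[rule_format]
  have fL: "f \<in> L2 G vw" and gL: "g \<in> L2 G vw"
    using finite_support_L2[OF H.finite_verts sub] f g by blast+
  have Qf: "arc_form f k = of_real a * l2_inner G vw f k"
    and Qg: "arc_form g k = c * l2_inner G vw f k + of_real b * l2_inner G vw g k"
    if k: "\<And>v. v \<notin> verts H \<Longrightarrow> k v = 0" for k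
  proof -
    have kL: "k \<in> L2 G vw" using finite_support_L2[OF H.finite_verts sub] k by blast
    show "arc_form f k = of_real a * l2_inner G vw f k"
      using arc_form_induced[OF ind H.finite_verts f k, where u = "\<lambda>v. of_real a * f v + 0 * f v"]
        l2_inner_lin_left[OF fL fL kL, of "of_real a" 0] Tf by simp
    show "arc_form g k = c * l2_inner G vw f k + of_real b * l2_inner G vw g k"
      using arc_form_induced[OF ind H.finite_verts g k Tg] l2_inner_lin_left[OF fL gL kL] by simp
  qed
  have ff: "l2_inner G vw f f \<noteq> 0" using l2_inner_pos[OF fL ne(1)] by auto
  define d where "d = l2_inner G vw g f / l2_inner G vw f f"
  define g' where "g' = (\<lambda>v. 1 * g v + (- d) * f v)"
  have g'0: "g' v = 0" if "v \<notin> verts H" for v using f g that by (simp add: g'_def)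
  have g'L: "g' \<in> L2 G vw" unfolding g'_def by (rule L2_lin[OF gL fL])
  have "g' \<noteq> (\<lambda>_. 0)"
  proof
    assume z: "g' = (\<lambda>_. 0)"
    have "g v = d * f v" for v using fun_cong[OF z, of v] by (simp add: g'_def)
    then show False using ne(2)[of d] by blast
  qed
  moreover have g'f: "l2_inner G vw g' f = 0"
    unfolding g'_def l2_inner_lin_left[OF gL fL fL] using ff by (simp add: d_def)
  then have fg': "l2_inner G vw f g' = 0" by (subst l2_inner_hermitian) simp
  moreover have Qfg': "arc_form f g' = 0" using Qf[OF g'0] fg' by simp
  moreover have "arc_form g' g' = of_real b * l2_inner G vw g' g'"
  proof -
    have "arc_form g' g' = arc_form g g' - d * arc_form f g'"
      using arc_form_lin_left[OF gL fL g'L, of 1 "- d", folded g'_def] by simp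
    also have "\<dots> = of_real b * l2_inner G vw g g'" using Qg[OF g'0] fg' Qfg' by simp
    \<comment> \<open>The difference of \<open>g\<close> and \<open>g'\<close> is a multiple of
      \<open>f\<close>, which is orthogonal to \<open>g'\<close>.\<close>
    also have "l2_inner G vw g g' = l2_inner G vw g' g'"
      using l2_inner_lin_left[OF gL fL g'L, of 1 "- d", folded g'_def] fg' by simp
    finally show ?thesis .
  qed
  moreover have "arc_form f f = of_real a * l2_inner G vw f f" by (rule Qf) (rule f)
  ultimately show ?thesis using that[OF fL g'L ne(1)] by blast
qed

text \<open>A min-max argument for \<open>s\<close> times the operator, whose two lowest eigenvalues
  on the subgraph are meant to be \<open>s * a\<close> and \<open>s * b\<close>. The sign
  \<open>s\<close> lets one proof serve both ends of the spectrum.\<close>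

lemma first_two_eigenvalues:
  fixes a b :: real
  assumes s: "s = 1 \<or> s = - 1"
    and ind: "induced_subgraph H G" and fin: "fin_digraph H"
    and vs: "distinct vs" "set vs = verts H"
    and cp: "char_poly (op_matrix vs (adj_op H vw ew)) = (\<Prod>x\<leftarrow>a # b # es. [:- complex_of_real x, 1:])"
    and ab: "s * a \<le> s * b"
    and bd: "\<And>f. f \<in> L20 G VO VI vw \<Longrightarrow> \<kappa> * Re (l2_inner G vw f f) \<le> s * Re (arc_form f f)"
    and mu: "\<kappa> \<le> real q + 1"
  shows "- (real q + 1) \<le> s * a \<and> \<kappa> \<le> s * b"
proof -
  obtain f g where fg: "f \<in> L2 G vw" "g \<in> L2 G vw" "f \<noteq> (\<lambda>_. 0)" "g \<noteq> (\<lambda>_. 0)"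
    "l2_inner G vw f g = 0" "arc_form f f = of_real a * l2_inner G vw f f"
    "arc_form f g = 0" "arc_form g g = of_real b * l2_inner G vw g g"
    by (rule two_orthogonal_eigenfunctions[OF ind fin vs cp])
  have gf: "l2_inner G vw g f = 0" "arc_form g f = 0"
    using fg(5,7) by (subst l2_inner_hermitian arc_form_hermitian; simp)+
  define F where "F = Re (l2_inner G vw f f)"
  define K where "K = Re (l2_inner G vw g g)"
  have F: "0 < F" and K: "0 < K"
    unfolding F_def K_def using fg by (auto intro: l2_inner_pos)
  have Feq: "l2_inner G vw f f = of_real F" and Keq: "l2_inner G vw g g = of_real K"
    using L2_sq_has_sum(2) fg(1,2) by (auto simp: F_def K_def complex_eq_iff)
  have "\<bar>a * F\<bar> \<le> (real q + 1) * F"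
    using arc_form_bound[OF fg(1)] fg(6) Feq by simp
  then have "\<bar>a\<bar> \<le> real q + 1" using F by (simp add: abs_mult)
  then have 1: "- (real q + 1) \<le> s * a" using s by auto
  let ?\<psi> = "sign_fun (- s)"
  \<comment> \<open>One linear condition on a plane has a nonzero solution. The function
    \<open>sign_fun (- s)\<close> is avoided because \<open>s\<close> times the operator has its
    lowest eigenvalue \<open>- (q + 1)\<close> there.\<close>
  obtain \<alpha> \<beta> where nz: "\<alpha> \<noteq> 0 \<or> \<beta> \<noteq> 0"
    and ort: "\<alpha> * l2_inner G vw f ?\<psi> + \<beta> * l2_inner G vw g ?\<psi> = 0"
  proof (cases "l2_inner G vw f ?\<psi> = 0")
    case True
    then show ?thesis using that[of 1 0] by simp
  next
    case False
    then show ?thesis using that[of "l2_inner G vw g ?\<psi>" "- l2_inner G vw f ?\<psi>"] by simp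
  qed
  define h where "h = (\<lambda>v. \<alpha> * f v + \<beta> * g v)"
  have h: "h \<in> L2 G vw" unfolding h_def by (rule L2_lin[OF fg(1,2)])
  have h\<psi>: "l2_inner G vw h ?\<psi> = 0"
    unfolding h_def l2_inner_lin_left[OF fg(1,2) sign_fun_L2] by (rule ort)
  define A where "A = (cmod \<alpha>)\<^sup>2 * F"
  define B where "B = (cmod \<beta>)\<^sup>2 * K"
  have AB: "0 \<le> A" "0 \<le> B" "0 < A + B"
    using F K nz by (auto simp: A_def B_def add_pos_nonneg add_nonneg_pos)
  have "l2_inner G vw h h = (\<alpha> * cnj \<alpha>) * of_real F + (\<beta> * cnj \<beta>) * of_real K"
    unfolding h_def l2_inner_lin_left[OF fg(1,2) h[unfolded h_def]]
      l2_inner_lin_right[OF fg(1,2) fg(1)] l2_inner_lin_right[OF fg(1,2) fg(2)]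
    by (simp add: fg(5) gf Feq Keq)
  then have N: "Re (l2_inner G vw h h) = A + B"
    unfolding A_def B_def complex_norm_square[symmetric] by (simp del: of_real_power)
  have "arc_form h h = (\<alpha> * cnj \<alpha>) * of_real (a * F) + (\<beta> * cnj \<beta>) * of_real (b * K)"
    unfolding h_def arc_form_lin_left[OF fg(1,2) h[unfolded h_def]]
      arc_form_lin_right[OF fg(1,2) fg(1)] arc_form_lin_right[OF fg(1,2) fg(2)]
    by (simp add: fg(6,7,8) gf Feq Keq)
  then have Q: "Re (arc_form h h) = a * A + b * B"
    unfolding A_def B_def complex_norm_square[symmetric] by (simp del: of_real_power)
  have ne: "verts G \<noteq> {}"
    using fg(1,3) by (auto simp: L2_def)
  have "\<kappa> * (A + B) \<le> s * (a * A + b * B)"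
    using arc_form_ge_of_L20[OF s ne h h\<psi> bd mu] unfolding N Q .
  \<comment> \<open>The Rayleigh quotient of \<open>h\<close> is a weighted mean of \<open>a\<close>
    and \<open>b\<close>, so after multiplication by \<open>s\<close> it is at most
    \<open>s * b\<close>.\<close>
  also have "\<dots> \<le> s * b * (A + B)"
    using mult_right_mono[OF ab AB(1)] by (simp add: algebra_simps)
  finally have "\<kappa> \<le> s * b" using AB(3) by (rule mult_right_le_imp_le)
  with 1 show ?thesis ..
qed

end

section \<open>Both ends of the spectrum\<close>

theorem theorem3p7:
  fixes G H :: "('v, 'e) pre_digraph" and arev :: "'e \<Rightarrow> 'e" and VO VI :: "'v set"
    and vw :: "'v \<Rightarrow> nat" and ew :: "'e \<Rightarrow> nat" and q n :: nat and ls :: "real list"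
  assumes "regular_diagram G arev VO VI vw ew q"
    and "L20 G VO VI vw \<noteq> {\<lambda>_. 0}"
    and "induced_subgraph H G"
    and "fin_digraph H"
    and "Digraph_Component.connected H"
    and "n = card (verts H)"
    and "n \<ge> 2"
    and "eigenvalue_list (verts H) (adj_op H vw ew) ls"
  shows "- (real q + 1) \<le> ls ! 0 \<and>
         m_const G VO VI vw ew \<le> ls ! 1 \<and>
         ls ! (n - 2) \<le> M_const G VO VI vw ew \<and>
         ls ! (n - 1) \<le> real q + 1"
proof -
  interpret regular_diagram G arev VO VI vw ew q by fact
  obtain vs where vs: "distinct vs" "set vs = verts H" and sorted: "sorted ls"
    and cp: "char_poly (op_matrix vs (adj_op H vw ew)) = (\<Prod>x\<leftarrow>ls. [:- complex_of_real x, 1:])"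
    using assms(8) unfolding eigenvalue_list_def by blast
  have "length vs = n" using vs assms(6) distinct_card by fastforce
  then have "op_matrix vs (adj_op H vw ew) \<in> carrier_mat n n" by (simp add: op_matrix_def)
  \<comment> \<open>Comparing degrees shows that \<open>ls\<close> has exactly \<open>n\<close>
    entries, so all four list indices in the claim are in range.\<close>
  then have "degree (\<Prod>x\<leftarrow>ls. [:- complex_of_real x, 1:]) = n"
    using degree_monic_char_poly cp by metis
  moreover have "degree (\<Prod>x\<leftarrow>ls. [:- complex_of_real x, 1:]) = length ls"
    using degree_linear_factors[of "\<lambda>x. - complex_of_real x" ls] by simp
  ultimately have len: "length ls = n" by simp
  obtain a b es where ls: "ls = a # b # es"
    using len assms(7) by (metis Suc_le_length_iff numeral_2_eq_2)
  have low: "- (real q + 1) \<le> 1 * a \<and> m_const G VO VI vw ew \<le> 1 * b"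
  proof (rule first_two_eigenvalues[OF _ assms(3,4) vs cp[unfolded ls]])
    show "1 * a \<le> 1 * b" using sorted ls by simp
  qed (use m_const_M_const_bounds[OF assms(2)] in auto)
  \<comment> \<open>Reversal puts the two largest eigenvalues first; the product of linear factors
    does not change.\<close>
  define rs where "rs = rev ls"
  obtain c d es' where rs: "rs = c # d # es'"
    using len assms(7) by (metis rs_def length_rev Suc_le_length_iff numeral_2_eq_2)
  have "(\<Prod>x\<leftarrow>ls. [:- complex_of_real x, 1:]) = (\<Prod>x\<leftarrow>rs. [:- complex_of_real x, 1:])"
    unfolding rs_def by (simp add: prod_list.rev flip: rev_map)
  then have cp': "char_poly (op_matrix vs (adj_op H vw ew)) =
      (\<Prod>x\<leftarrow>c # d # es'. [:- complex_of_real x, 1:])"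
    using cp rs by simp
  have nth: "rs ! 0 = ls ! (n - 1)" "rs ! 1 = ls ! (n - 2)"
    using len assms(7) by (auto simp: rs_def rev_nth numeral_2_eq_2)
  \<comment> \<open>The case \<open>s = -1\<close> with \<kappa> = -M: negation turns lower bounds
    for the negated operator into upper bounds for the largest eigenvalues.\<close>
  have high: "- (real q + 1) \<le> - 1 * c \<and> - M_const G VO VI vw ew \<le> - 1 * d"
  proof (rule first_two_eigenvalues[OF _ assms(3,4) vs cp'])
    have "ls ! (n - 2) \<le> ls ! (n - 1)"
      using sorted len assms(7) by (intro sorted_nth_mono) auto
    then show "- 1 * c \<le> - 1 * d" using nth rs by simp
  qed (use m_const_M_const_bounds[OF assms(2)] in auto)
  show ?thesis using low high ls nth rs by simp
qed

end
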